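(* Let $n\ge1$ and $\sigma\in S_n$. Then $H(\sigma)=\sigma$ if and only if $\sigma$ is a strong fixed point of Foata's map, i.e. $\phi_k(\sigma)=\sigma$ for all $1\le k\le n$.
   Context: $S_n$ is the set of permutations of $[n]$ in one-line notation. Han's map: for $x\in[n]$ and a permutation $\sigma=\sigma_1\cdots\sigma_{n-1}$ of $[n]\setminus\{x\}$, let $C^x(\sigma)=\tau_1\cdots\tau_{n-1}\in S_{n-1}$ with $\tau_i=\sigma_i-x+n$ if $\sigma_i<x$ and $\tau_i=\sigma_i-x$ if $\sigma_i>x$, and $C_x(\sigma)=\nu_1\cdots\nu_{n-1}\in S_{n-1}$ with $\nu_i=\sigma_i$ if $\sigma_i<x$, $\nu_i=\sigma_i-1$ if $\sigma_i>x$. Then $H(1)=1$ and for $n>1$, $H(\sigma)=C_{\sigma_n}^{-1}\big(H(C^{\sigma_n}(\sigma_1\cdots\sigma_{n-1}))\big)\cdot\sigma_n$. Foata's operator $\gamma_x$: for a word $w=w_1\cdots w_m$ of distinct integers and an integer $x$, if $w_m\le x$ write $w=v_1b_1v_2b_2\cdots v_pb_p$ where each $b_i\le x$ and all letters of each (possibly empty) factor $v_i$ are $>x$; if $w_m>x$ write $w=v_1b_1\cdots v_pb_p$ where each $b_i>x$ and all letters of each $v_i$ are $\le x$; in either case $\gamma_x(w)=b_1v_1b_2v_2\cdots b_pv_p$. The partial Foata maps $\phi_k\colon S_n\to S_n$ ($1\le k\le n$) are $\phi_1(\sigma)=\sigma$ and, for $k>1$, $\phi_k(\sigma)=\gamma_{\sigma_k}(\sigma_1\cdots\sigma_{k-1})\cdot\sigma_k\sigma_{k+1}\cdots\sigma_n$.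 A permutation $\sigma$ is a strong fixed point of Foata's map if $\phi_k(\sigma)=\sigma$ for all $1\le k\le n$. *)

theory Defs
  imports Main "HOL-Combinatorics.Multiset_Permutations"
begin

text \<open>
  Permutations are in one-line notation, as lists over the letters \<open>1, \<dots>, n\<close>; thus
  the set \<open>S\<^sub>n\<close> is \<^term>\<open>permutations_of_set {1..n::nat}\<close>, and the letter \<open>\<sigma>\<^sub>k\<close> is
  \<^term>\<open>\<sigma> ! (k - 1)\<close>.
\<close>

text \<open>Since \<open>x \<le> n\<close>, the truncated subtraction in \<open>s + n - x\<close> computes \<open>s - x + n\<close>.\<close>

definition han_C_upper :: "nat \<Rightarrow> nat \<Rightarrow> nat list \<Rightarrow> nat list" where
  "han_C_upper n x = map (\<lambda>s. if s < x then s + n - x else s - x)"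

definition han_C_lower :: "nat \<Rightarrow> nat list \<Rightarrow> nat list" where
  "han_C_lower x = map (\<lambda>s. if s < x then s else s - 1)"

definition han_C_lower_inv :: "nat \<Rightarrow> nat \<Rightarrow> nat list \<Rightarrow> nat list" where
  "han_C_lower_inv n x = the_inv_into (permutations_of_set ({1..n} - {x})) (han_C_lower x)"

function han :: "nat list \<Rightarrow> nat list" where
  "han \<sigma> =
    (if length \<sigma> \<le> 1 then \<sigma>
     else han_C_lower_inv (length \<sigma>) (last \<sigma>)
            (han (han_C_upper (length \<sigma>) (last \<sigma>) (butlast \<sigma>))) @ [last \<sigma>])"
  by auto
termination
  by (relation "measure length") (auto simp: han_C_upper_def)

declare han.simps [simp del]

text \<open>
  A factorization \<open>w = v\<^sub>1 b\<^sub>1 \<dots> v\<^sub>p b\<^sub>p\<close> is the list of pairs \<open>(v\<^sub>i, b\<^sub>i)\<close>. The predicate \<open>P\<close>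
  selects the letters \<open>b\<^sub>i\<close>: it is \<open>(\<le> x)\<close> or \<open>(> x)\<close> according to the last letter of \<open>w\<close>.
\<close>

definition is_factorization :: "('a \<Rightarrow> bool) \<Rightarrow> 'a list \<Rightarrow> ('a list \<times> 'a) list \<Rightarrow> bool" where
  "is_factorization P w ps \<longleftrightarrow>
     w = concat (map (\<lambda>(v, b). v @ [b]) ps) \<and>
     (\<forall>(v, b) \<in> set ps. P b \<and> (\<forall>a \<in> set v. \<not> P a))"

definition foata_gamma :: "'a::linorder \<Rightarrow> 'a list \<Rightarrow> 'a list" where
  "foata_gamma x w =
     (let P = (if last w \<le> x then (\<lambda>a. a \<le> x) else (\<lambda>a. a > x))
      in concat (map (\<lambda>(v, b). b # v) (THE ps. is_factorization P w ps)))"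

definition foata_phi :: "nat \<Rightarrow> nat list \<Rightarrow> nat list" where
  "foata_phi k \<sigma> =
     (if k \<le> 1 then \<sigma>
      else foata_gamma (\<sigma> ! (k - 1)) (take (k - 1) \<sigma>) @ drop (k - 1) \<sigma>)"

definition strong_fixed_point :: "nat list \<Rightarrow> bool" where
  "strong_fixed_point \<sigma> \<longleftrightarrow> (\<forall>k \<in> {1..length \<sigma>}. foata_phi k \<sigma> = \<sigma>)"

text \<open>The inverse and the definite description above are well defined.\<close>

lemma bij_betw_han_C_lower:
  assumes "x \<in> {1..n}"
  shows "bij_betw (han_C_lower x) (permutations_of_set ({1..n} - {x})) (permutations_of_set {1..n - 1})"
proof (rule bij_betw_byWitness[where f' = "map (\<lambda>s. if s < x then s else s + 1)"])
  let ?f = "\<lambda>s. if s < x then s else s - 1" and ?g = "\<lambda>s::nat. if s < x then s else s + 1"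
  have f: "inj_on ?f ({1..n} - {x})" "?f ` ({1..n} - {x}) \<subseteq> {1..n - 1}"
    using assms by (auto simp: inj_on_def split: if_splits)
  have g: "inj ?g" "?g ` {1..n - 1} \<subseteq> {1..n} - {x}"
    using assms by (auto simp: inj_on_def split: if_splits)
  have fg: "?f (?g s) = s" for s by auto
  have gf: "?g (?f s) = s" if "s \<noteq> x" for s using that by auto
  have f': "?f ` ({1..n} - {x}) = {1..n - 1}"
  proof
    show "{1..n - 1} \<subseteq> ?f ` ({1..n} - {x})"
    proof
      fix s assume "s \<in> {1..n - 1}"
      then have "?g s \<in> {1..n} - {x}" using g(2) by blast
      then show "s \<in> ?f ` ({1..n} - {x})" by (intro image_eqI[of s ?f "?g s"] fg[symmetric])
    qed
  qed (rule f(2))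
  have g': "?g ` {1..n - 1} = {1..n} - {x}"
  proof
    show "{1..n} - {x} \<subseteq> ?g ` {1..n - 1}"
    proof
      fix s assume s: "s \<in> {1..n} - {x}"
      then have "?f s \<in> {1..n - 1}" using f(2) by blast
      moreover have "?g (?f s) = s" using s by (intro gf) auto
      ultimately show "s \<in> ?g ` {1..n - 1}" by (intro image_eqI[of s ?g "?f s"] sym[of "?g (?f s)" s])
    qed
  qed (rule g(2))
  show "\<forall>a\<in>permutations_of_set ({1..n} - {x}). map ?g (han_C_lower x a) = a"
  proof
    fix a assume "a \<in> permutations_of_set ({1..n} - {x})"
    then have "set a = {1..n} - {x}" by (rule permutations_of_setD)
    then have "(?g \<circ> ?f) s = s" if "s \<in> set a" for s
      unfolding o_def using that by (intro gf) blast
    then show "map ?g (han_C_lower x a) = a"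
      unfolding han_C_lower_def map_map by (rule map_idI)
  qed
  show "\<forall>a\<in>permutations_of_set {1..n - 1}. han_C_lower x (map ?g a) = a"
  proof
    fix a
    have "(?f \<circ> ?g) s = s" for s unfolding o_def by (rule fg)
    then show "han_C_lower x (map ?g a) = a"
      unfolding han_C_lower_def map_map by (rule map_idI)
  qed
  show "han_C_lower x ` permutations_of_set ({1..n} - {x}) \<subseteq> permutations_of_set {1..n - 1}"
  proof
    fix t assume "t \<in> han_C_lower x ` permutations_of_set ({1..n} - {x})"
    then obtain s where s: "set s = {1..n} - {x}" "distinct s" and t: "t = map ?f s"
      unfolding han_C_lower_def permutations_of_set_def by blast
    have "set t = {1..n - 1}" unfolding t set_map s(1) by (rule f')
    moreover have "distinct t" unfolding t distinct_map s(1) using s(2) f(1) by blast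
    ultimately show "t \<in> permutations_of_set {1..n - 1}" by (rule permutations_of_setI)
  qed
  show "map ?g ` permutations_of_set {1..n - 1} \<subseteq> permutations_of_set ({1..n} - {x})"
  proof
    fix t assume "t \<in> map ?g ` permutations_of_set {1..n - 1}"
    then obtain s where s: "set s = {1..n - 1}" "distinct s" and t: "t = map ?g s"
      unfolding permutations_of_set_def by blast
    have "set t = {1..n} - {x}" unfolding t set_map s(1) by (rule g')
    moreover have "distinct t"
      unfolding t distinct_map using s(2) inj_on_subset[OF g(1) subset_UNIV] by blast
    ultimately show "t \<in> permutations_of_set ({1..n} - {x})" by (rule permutations_of_setI)
  qed
qed

lemma is_factorization_ex:
  assumes "w = [] \<or> P (last w)"
  shows "\<exists>ps. is_factorization P w ps"
  using assms
proof (induction w)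
  case Nil
  have "is_factorization P [] []" by (simp add: is_factorization_def)
  then show ?case ..
next
  case (Cons a w)
  show ?case
  proof (cases "w = []")
    case True
    then have "is_factorization P (a # w) [([], a)]"
      using Cons.prems by (simp add: is_factorization_def)
    then show ?thesis ..
  next
    case False
    then obtain ps where ps: "is_factorization P w ps" using Cons by auto
    show ?thesis
    proof (cases "P a")
      case True
      then have "is_factorization P (a # w) (([], a) # ps)"
        using ps by (simp add: is_factorization_def)
      then show ?thesis ..
    next
      case nP: False
      obtain v b qs where "ps = (v, b) # qs"
        using ps False by (cases ps) (auto simp: is_factorization_def)
      then have "is_factorization P (a # w) ((a # v, b) # qs)"
        using ps nP by (simp add: is_factorization_def)
      then show ?thesis ..
    qed
  qed
qed

lemma is_factorization_unique:
  assumes "is_factorization P w ps" "is_factorization P w qs"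
  shows "ps = qs"
  using assms
proof (induction ps arbitrary: w qs)
  case Nil
  then show ?case by (cases qs) (auto simp: is_factorization_def)
next
  case (Cons p ps)
  obtain v b where p: "p = (v, b)" by (cases p)
  obtain v' b' qs' where qs: "qs = (v', b') # qs'"
    using Cons.prems p by (cases qs) (auto simp: is_factorization_def)
  define r where "r = concat (map (\<lambda>(v, b). v @ [b]) ps)"
  define r' where "r' = concat (map (\<lambda>(v, b). v @ [b]) qs')"
  have eq: "v @ b # r = v' @ b' # r'"
    using Cons.prems p qs by (simp add: is_factorization_def r_def r'_def)
  have v: "\<forall>a\<in>set v. \<not> P a" "P b" "\<forall>a\<in>set v'. \<not> P a" "P b'"
    using Cons.prems p qs by (auto simp: is_factorization_def)
  have "takeWhile (\<lambda>a. \<not> P a) (v @ b # r) = v" "takeWhile (\<lambda>a. \<not> P a) (v' @ b' # r') = v'"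
    using v by (auto simp: takeWhile_append)
  with eq have "v = v'" by metis
  with eq have "b = b'" "r = r'" by auto
  moreover have "is_factorization P r ps" "is_factorization P r' qs'"
    using Cons.prems p qs by (auto simp: is_factorization_def r_def r'_def)
  ultimately show ?case using Cons.IH \<open>v = v'\<close> p qs by auto
qed

lemma is_factorization_ex1:
  assumes "P = (if last w \<le> x then (\<lambda>a. a \<le> x) else (\<lambda>a. a > (x::'a::linorder)))"
  shows "\<exists>!ps. is_factorization P w ps"
proof -
  have "P (last w)" using assms by auto
  then show ?thesis using is_factorization_ex is_factorization_unique by metis
qed

end

theory Submission
  imports Defs
begin

text \<open>
  The operator \<open>\<gamma>\<^sub>x\<close> fixes \<open>w\<close> iff \<open>x\<close> is larger or smaller than every letter of \<open>w\<close>, so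
  the strong fixed points are the permutations each of whose letters is a left-to-right maximum or
  minimum. On the other side, \<open>H \<sigma> = \<sigma>\<close> means \<open>H (C\<^sup>x \<sigma>') = C\<^sub>x \<sigma>'\<close> where \<open>\<sigma> = \<sigma>' x\<close>. As \<open>H\<close>
  preserves the last letter, \<open>C\<^sup>x \<sigma>'\<close> and \<open>C\<^sub>x \<sigma>'\<close> then have the same last letter, which
  forces \<open>x \<in> {1, n}\<close>; in both of these cases \<open>C\<^sup>x \<sigma>' = C\<^sub>x \<sigma>'\<close>, and one concludes by induction.
\<close>

text \<open>A nonempty first \<open>v\<close> makes \<open>w\<close> begin with a letter violating
  \<open>P\<close>, whereas the rearranged word begins with \<open>b\<close>, which satisfies it.
  Hence equality forces every \<open>v\<close> to be empty.\<close>

lemma concat_swap_factorization_eq_iff: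
  assumes "is_factorization P w ps"
  shows "concat (map (\<lambda>(v, b). b # v) ps) = w \<longleftrightarrow> (\<forall>a\<in>set w. P a)"
  using assms
proof (induction ps arbitrary: w)
  case Nil
  then show ?case by (simp add: is_factorization_def)
next
  case (Cons p ps)
  obtain v b where p: "p = (v, b)" by (cases p)
  define r where "r = concat (map (\<lambda>(v, b). v @ [b]) ps)"
  have w: "w = v @ b # r" and vb: "P b" "\<forall>a\<in>set v. \<not> P a" and "is_factorization P r ps"
    using Cons.prems by (auto simp: is_factorization_def r_def p)
  then have IH: "concat (map (\<lambda>(v, b). b # v) ps) = r \<longleftrightarrow> (\<forall>a\<in>set r. P a)"
    using Cons.IH by blast
  show ?case
  proof (cases v)
    case Nil
    then show ?thesis using IH vb by (simp add: p w)
  next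
    case (Cons c v')
    then show ?thesis using vb by (auto simp: p w)
  qed
qed

lemma foata_gamma_eq_iff:
  assumes "x \<notin> set w"
  shows "foata_gamma x w = w \<longleftrightarrow> (\<forall>a\<in>set w. a < x) \<or> (\<forall>a\<in>set w. x < a)"
proof -
  define P where "P = (if last w \<le> x then (\<lambda>a. a \<le> x) else (\<lambda>a. a > x))"
  have "is_factorization P w (THE ps. is_factorization P w ps)"
    by (rule theI') (rule is_factorization_ex1[OF P_def])
  then have "foata_gamma x w = w \<longleftrightarrow> (\<forall>a\<in>set w. P a)"
    unfolding foata_gamma_def Let_def P_def[symmetric] by (rule concat_swap_factorization_eq_iff)
  also have "\<dots> \<longleftrightarrow> (\<forall>a\<in>set w. a < x) \<or> (\<forall>a\<in>set w. x < a)"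
  proof (cases "w = []")
    case False
    \<comment> \<open>\<open>last w\<close> satisfies \<open>P\<close> by the choice of
      \<open>P\<close>, so it refutes the disjunct on the other side of \<open>x\<close>;
      \<open>x \<notin> set w\<close> makes \<le> strict.\<close>
    then have "last w \<in> set w" by simp
    then show ?thesis using assms by (force simp: P_def le_less)
  qed simp
  finally show ?thesis .
qed

lemma foata_phi_snoc: "k \<le> length w \<Longrightarrow> foata_phi k (w @ [x]) = foata_phi k w @ [x]"
  by (auto simp: foata_phi_def nth_append)

lemma strong_fixed_point_Nil: "strong_fixed_point []"
  by (simp add: strong_fixed_point_def)

text \<open>For \<open>k \<le> length w\<close> the map \<open>foata_phi k\<close> does not see the
  appended letter, so only \<open>k = Suc (length w)\<close> adds a condition.\<close>

lemma strong_fixed_point_snoc_iff: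
  assumes "x \<notin> set w"
  shows "strong_fixed_point (w @ [x]) \<longleftrightarrow>
    strong_fixed_point w \<and> ((\<forall>a\<in>set w. a < x) \<or> (\<forall>a\<in>set w. x < a))"
proof -
  have "{1..length (w @ [x])} = insert (Suc (length w)) {1..length w}" by auto
  moreover have "foata_phi (Suc (length w)) (w @ [x]) = w @ [x] \<longleftrightarrow>
      (\<forall>a\<in>set w. a < x) \<or> (\<forall>a\<in>set w. x < a)"
    using foata_gamma_eq_iff[OF assms] by (cases "w = []") (auto simp: foata_phi_def)
  ultimately show ?thesis
    by (auto simp: strong_fixed_point_def foata_phi_snoc simp del: length_append)
qed

text \<open>The criterion for appending a letter only compares letters, so it survives an
  order-preserving relabelling.\<close>

lemma strong_fixed_point_map_iff:
  assumes "strict_mono_on (set w) f" "distinct w"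
  shows "strong_fixed_point (map f w) \<longleftrightarrow> strong_fixed_point w"
  using assms
proof (induction w rule: rev_induct)
  case (snoc x w)
  have "f a < f b \<longleftrightarrow> a < b" if "a \<in> set (w @ [x])" "b \<in> set (w @ [x])" for a b
    using strict_mono_on_less[OF snoc.prems(1)] that by blast
  moreover have "f x \<notin> set (map f w)"
    using strict_mono_on_imp_inj_on[OF snoc.prems(1)] snoc.prems(2) by (auto simp: inj_on_def)
  moreover have "strong_fixed_point (map f w) \<longleftrightarrow> strong_fixed_point w"
    using snoc by (auto simp: strict_mono_on_def)
  ultimately show ?case
    using snoc.prems(2) by (simp add: strong_fixed_point_snoc_iff)
qed (simp add: strong_fixed_point_Nil)

lemma last_han: "last (han \<sigma>) = last \<sigma>"
  by (subst han.simps) simp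

lemma han_snoc:
  "w \<noteq> [] \<Longrightarrow> han (w @ [x]) =
    han_C_lower_inv (Suc (length w)) x (han (han_C_upper (Suc (length w)) x w)) @ [x]"
  by (subst han.simps) simp

text \<open>Modulo \<open>n\<close> every letter is shifted by -x, and the missing letter is the one
  that would become 0.\<close>

lemma han_C_upper_in_permutations:
  assumes "x \<in> {1..n}" and w: "w \<in> permutations_of_set ({1..n} - {x})"
  shows "han_C_upper n x w \<in> permutations_of_set {1..n - 1}"
proof -
  let ?f = "\<lambda>s. if s < x then s + n - x else s - x"
  have "inj_on ?f ({1..n} - {x})"
    using assms(1) by (auto simp: inj_on_def split: if_splits)
  moreover have "?f ` ({1..n} - {x}) = {1..n - 1}"
  proof (rule card_subset_eq)
    show "?f ` ({1..n} - {x}) \<subseteq> {1..n - 1}"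
      using assms(1) by auto
    show "card (?f ` ({1..n} - {x})) = card {1..n - 1}"
      using assms(1) card_image[OF calculation] by simp
  qed simp
  ultimately show ?thesis
    using w unfolding han_C_upper_def permutations_of_set_def by (auto simp: distinct_map)
qed

lemma permutations_of_atLeastAtMost_SucD:
  assumes "\<sigma> \<in> permutations_of_set {1..Suc n}"
  obtains w x where "\<sigma> = w @ [x]" "x \<in> {1..Suc n}" "w \<in> permutations_of_set ({1..Suc n} - {x})"
    "length w = n" "x \<notin> set w"
proof -
  from assms have "\<sigma> \<noteq> []" by (auto simp: permutations_of_set_def)
  then obtain w x where \<sigma>: "\<sigma> = w @ [x]" by (metis rev_exhaust)
  have "set \<sigma> = {1..Suc n}" "distinct \<sigma>"
    using assms by (auto dest: permutations_of_setD)
  moreover have "length \<sigma> = Suc n"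
    using length_finite_permutations_of_set[OF assms] by simp
  ultimately show thesis
    using \<sigma> by (intro that[of w x]) (auto simp: permutations_of_set_def)
qed

text \<open>\<open>the_inv_into\<close> inverts \<open>han_C_lower x\<close> only on the image of
  the bijection; this closure property allows cancelling it in
  \<open>han_snoc_eq_iff\<close>.\<close>

lemma han_in_permutations:
  "\<sigma> \<in> permutations_of_set {1..n} \<Longrightarrow> han \<sigma> \<in> permutations_of_set {1..n}"
proof (induction n arbitrary: \<sigma>)
  case 0
  then show ?case by (simp add: han.simps)
next
  case (Suc n)
  from Suc.prems obtain w x where \<sigma>: "\<sigma> = w @ [x]" and x: "x \<in> {1..Suc n}"
    and w: "w \<in> permutations_of_set ({1..Suc n} - {x})" and len: "length w = n"
    by (rule permutations_of_atLeastAtMost_SucD)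
  show ?case
  proof (cases "w = []")
    case True
    then show ?thesis using Suc.prems by (simp add: \<sigma> han.simps)
  next
    case False
    define u where "u = han_C_lower_inv (Suc n) x (han (han_C_upper (Suc n) x w))"
    have "han (han_C_upper (Suc n) x w) \<in> permutations_of_set {1..n}"
      using han_C_upper_in_permutations[OF x w] by (intro Suc.IH) simp
    then have u: "u \<in> permutations_of_set ({1..Suc n} - {x})"
      using bij_betw_the_inv_into[OF bij_betw_han_C_lower[OF x]]
      by (auto simp: u_def han_C_lower_inv_def dest: bij_betwE)
    have han: "han \<sigma> = u @ [x]" using False len by (simp add: \<sigma> u_def han_snoc)
    show ?thesis
      unfolding han
      using permutations_of_setD[OF u] x by (intro permutations_of_setI) (simp_all add: insert_absorb)
  qed
qed

lemma han_snoc_eq_iff: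
  assumes x: "x \<in> {1..Suc n}" and w: "w \<in> permutations_of_set ({1..Suc n} - {x})"
    and "length w = n" "w \<noteq> []"
  shows "han (w @ [x]) = w @ [x] \<longleftrightarrow> han (han_C_upper (Suc n) x w) = han_C_lower x w"
proof -
  let ?u = "han (han_C_upper (Suc n) x w)"
  note bij = bij_betw_han_C_lower[OF x]
  have "?u \<in> permutations_of_set {1..Suc n - 1}"
    by (intro han_in_permutations han_C_upper_in_permutations x w)
  then have "han_C_lower_inv (Suc n) x ?u = w \<longleftrightarrow> ?u = han_C_lower x w"
    unfolding han_C_lower_inv_def
    using f_the_inv_into_f_bij_betw[OF bij] the_inv_into_f_f[OF bij_betw_imp_inj_on[OF bij] w]
    by metis
  then show ?thesis using assms by (simp add: han_snoc)
qed

text \<open>With s = \<open>last w\<close>, the equation reads s + n - x = s if s < x, giving x = n,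
  and s - x = s - 1 if s > x, giving x = 1.\<close>

lemma last_han_C_eq_imp_extreme:
  assumes "x \<in> {1..n}" "w \<in> permutations_of_set ({1..n} - {x})" "w \<noteq> []"
    and "last (han_C_upper n x w) = last (han_C_lower x w)"
  shows "x = 1 \<or> x = n"
proof -
  have "last w \<in> {1..n} - {x}" using assms(2,3) by (metis last_in_set permutations_of_setD(1))
  then show ?thesis
    using assms by (auto simp: han_C_upper_def han_C_lower_def last_map split: if_splits)
qed

lemma han_C_upper_eq_lower:
  assumes "w \<in> permutations_of_set ({1..n} - {x})" "x = 1 \<or> x = n"
  shows "han_C_upper n x w = han_C_lower x w"
  unfolding han_C_upper_def han_C_lower_def
proof (rule map_cong[OF refl])
  fix s assume "s \<in> set w"
  then have "s \<in> {1..n} - {x}" using permutations_of_setD(1)[OF assms(1)] by blast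
  then show "(if s < x then s + n - x else s - x) = (if s < x then s else s - 1)"
    using assms(2) by auto
qed

lemma strong_fixed_point_han_C_lower_iff:
  assumes "w \<in> permutations_of_set ({1..n} - {x})"
  shows "strong_fixed_point (han_C_lower x w) \<longleftrightarrow> strong_fixed_point w"
  unfolding han_C_lower_def
proof (rule strong_fixed_point_map_iff)
  \<comment> \<open>Since \<open>x\<close> is missing, letters s < x < t satisfy s < x \<le> t - 1,
    so lowering t causes no collision.\<close>
  have "strict_mono_on ({1..n} - {x}) (\<lambda>s. if s < x then s else s - 1)"
    by (auto simp: strict_mono_on_def)
  then show "strict_mono_on (set w) (\<lambda>s. if s < x then s else s - 1)"
    by (simp only: permutations_of_setD(1)[OF assms])
  show "distinct w" using assms by (rule permutations_of_setD)
qed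

theorem theorem3p1:
  fixes n :: nat and \<sigma> :: "nat list"
  assumes "n \<ge> 1" and "\<sigma> \<in> permutations_of_set {1..n}"
  shows "han \<sigma> = \<sigma> \<longleftrightarrow> strong_fixed_point \<sigma>"
  using assms(2)
proof (induction n arbitrary: \<sigma>)
  case 0
  then show ?case by (simp add: han.simps strong_fixed_point_Nil)
next
  case (Suc n)
  from Suc.prems obtain w x where \<sigma>: "\<sigma> = w @ [x]" and x: "x \<in> {1..Suc n}"
    and w: "w \<in> permutations_of_set ({1..Suc n} - {x})" and len: "length w = n"
    and nin: "x \<notin> set w"
    by (rule permutations_of_atLeastAtMost_SucD)
  note set_w = permutations_of_setD(1)[OF w]
  show ?case
  proof (cases "w = []")
    case True
    then show ?thesis
      by (simp add: \<sigma> han.simps strong_fixed_point_snoc_iff[of x "[]", simplified]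
          strong_fixed_point_Nil)
  next
    case False
    have extreme: "(\<forall>a\<in>set w. a < x) \<or> (\<forall>a\<in>set w. x < a) \<longleftrightarrow> x = 1 \<or> x = Suc n"
    proof
      assume *: "(\<forall>a\<in>set w. a < x) \<or> (\<forall>a\<in>set w. x < a)"
      show "x = 1 \<or> x = Suc n"
      proof (rule ccontr)
        assume "\<not> ?thesis"
        \<comment> \<open>Both extreme letters differ from \<open>x\<close>, hence occur in
          \<open>w\<close> and lie on opposite sides of \<open>x\<close>.\<close>
        then have "1 \<in> set w" "Suc n \<in> set w" by (auto simp: set_w)
        then have "Suc n < x \<or> x < 1" using * by blast
        then show False using x by simp
      qed
    qed (unfold set_w, auto)
    show ?thesis
    proof (cases "x = 1 \<or> x = Suc n")
      case True
      \<comment> \<open>The two images of \<open>w\<close> coincide here, so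
        \<open>han_snoc_eq_iff\<close> becomes a fixed point equation for
        \<open>han_C_lower x w\<close>, to which the induction hypothesis applies.\<close>
      have "han_C_lower x w \<in> permutations_of_set {1..n}"
        using bij_betwE[OF bij_betw_han_C_lower[OF x]] w by auto
      then have "han (han_C_lower x w) = han_C_lower x w \<longleftrightarrow> strong_fixed_point w"
        using Suc.IH strong_fixed_point_han_C_lower_iff[OF w] by simp
      then show ?thesis
        using han_snoc_eq_iff[OF x w len False] han_C_upper_eq_lower[OF w True] True extreme
        by (simp add: \<sigma> strong_fixed_point_snoc_iff[OF nin])
    next
      case nonextreme: False
      then have "han (han_C_upper (Suc n) x w) \<noteq> han_C_lower x w"
        using last_han_C_eq_imp_extreme[OF x w False] last_han by metis
      then show ?thesis
        using han_snoc_eq_iff[OF x w len False] nonextreme extreme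
        by (simp add: \<sigma> strong_fixed_point_snoc_iff[OF nin])
    qed
  qed
qed

end
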